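(* Let $D$ be an associative division ring, let $\sigma$ be an endomorphism of $D$ which is not surjective, and let $f(t)\in D[t;\sigma]$ be irreducible (of degree at least $2$). Then the Petit algebra $S_f$ is a right division algebra but not a left division algebra.
   Context: $R=D[t;\sigma]$ is the twisted polynomial ring: left polynomials $\sum a_it^i$ with $a_i\in D$ and multiplication determined by $ta=\sigma(a)t$ for $a\in D$. Every endomorphism of $D$ is injective. For $f(t)\ne 0$ and $g(t)\in R$ there are unique $q(t),r(t)\in R$ with $\deg(r)<\deg(f)$ and $g=qf+r$ (right division by $f$); write $g \bmod_r f:=r$. A polynomial $f(t)$ is irreducible if it is not a unit and there are no $g,h\in R$ with $\deg(g),\deg(h)<\deg(f)$ and $f=gh$. Petit algebra: for $f\in R$ of degree $m\ge 2$, let $R_m=\{g\in R : \deg(g)<m\}$ and $g\circ h=gh \bmod_r f$ for $g,h\in R_m$. Then $S_f=(R_m,\circ)$ is a unital, in general nonassociative, algebra over $F=\{c\in D : c\circ h=h\circ c \text{ for all } h\in S_f\}$. $S_f$ is a right (resp. left) division algebra if for every $0\neq a\in S_f$ the map $R_a:x\mapsto x\circ a$ (resp. $L_a:x\mapsto a\circ x$) from $S_f$ to $S_f$ is bijective. *)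

theory Defs
  imports "HOL-Computational_Algebra.Polynomial" "HOL-Algebra.Ring"
begin

text \<open>
  Ring endomorphisms are unital; over a division ring they are then automatically injective.
\<close>

definition ring_endomorphism :: "('a::division_ring \<Rightarrow> 'a) \<Rightarrow> bool" where
  "ring_endomorphism \<sigma> \<longleftrightarrow>
     (\<forall>a b. \<sigma> (a + b) = \<sigma> a + \<sigma> b) \<and> (\<forall>a b. \<sigma> (a * b) = \<sigma> a * \<sigma> b) \<and> \<sigma> 1 = 1"

text \<open>
  The twisted polynomial ring \<open>D[t;\<sigma>]\<close>, with coefficients written on the left, has the additive
  group of the library type of polynomials; only the multiplication differs, being given by
  \<open>(a t\<^sup>i) (b t\<^sup>j) = a \<sigma>\<^sup>i(b) t\<^sup>i\<^sup>+\<^sup>j\<close>. The commutative product of the type class is never used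
  (and is not available, since the coefficients need not commute).
\<close>

definition twisted_mult ::
    "('a::division_ring \<Rightarrow> 'a) \<Rightarrow> 'a poly \<Rightarrow> 'a poly \<Rightarrow> 'a poly" where
  "twisted_mult \<sigma> p q =
     (\<Sum>i\<le>degree p. \<Sum>j\<le>degree q. monom (coeff p i * (\<sigma> ^^ i) (coeff q j)) (i + j))"

definition twisted_poly_ring :: "('a::division_ring \<Rightarrow> 'a) \<Rightarrow> 'a poly ring" where
  "twisted_poly_ring \<sigma> =
     \<lparr>carrier = UNIV, mult = twisted_mult \<sigma>, one = [:1:], zero = 0, add = (+)\<rparr>"

text \<open>
  In the library \<open>degree 0 = 0\<close>, so the condition \<open>deg r < deg f\<close>, meant with \<open>deg 0 = -\<infinity>\<close>,
  needs the extra disjunct \<open>r = 0\<close>.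
\<close>

definition is_right_remainder ::
    "('a::division_ring \<Rightarrow> 'a) \<Rightarrow> 'a poly \<Rightarrow> 'a poly \<Rightarrow> 'a poly \<Rightarrow> bool" where
  "is_right_remainder \<sigma> f g r \<longleftrightarrow>
     (r = 0 \<or> degree r < degree f) \<and> (\<exists>q. g = twisted_mult \<sigma> q f + r)"

definition mod_right :: "('a::division_ring \<Rightarrow> 'a) \<Rightarrow> 'a poly \<Rightarrow> 'a poly \<Rightarrow> 'a poly" where
  "mod_right \<sigma> g f = (THE r. is_right_remainder \<sigma> f g r)"

definition twisted_irreducible :: "('a::division_ring \<Rightarrow> 'a) \<Rightarrow> 'a poly \<Rightarrow> bool" where
  "twisted_irreducible \<sigma> f \<longleftrightarrow>
     f \<notin> Units (twisted_poly_ring \<sigma>) \<and>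
     \<not> (\<exists>g h. degree g < degree f \<and> degree h < degree f \<and> f = twisted_mult \<sigma> g h)"

text \<open>
  The record type \<open>ring\<close> only serves as a signature here: the multiplication of a Petit algebra
  need not be associative. The definition is meant for \<open>degree f \<ge> 2\<close>.
\<close>

definition petit_algebra :: "('a::division_ring \<Rightarrow> 'a) \<Rightarrow> 'a poly \<Rightarrow> 'a poly ring" where
  "petit_algebra \<sigma> f =
     \<lparr>carrier = {g. degree g < degree f},
      mult = (\<lambda>g h. mod_right \<sigma> (twisted_mult \<sigma> g h) f),
      one = [:1:], zero = 0, add = (+)\<rparr>"

definition right_division_algebra :: "('b, 'm) ring_scheme \<Rightarrow> bool" where
  "right_division_algebra S \<longleftrightarrow>
     (\<forall>a\<in>carrier S. a \<noteq> \<zero>\<^bsub>S\<^esub> \<longrightarrow> bij_betw (\<lambda>x. x \<otimes>\<^bsub>S\<^esub> a) (carrier S) (carrier S))"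

definition left_division_algebra :: "('b, 'm) ring_scheme \<Rightarrow> bool" where
  "left_division_algebra S \<longleftrightarrow>
     (\<forall>a\<in>carrier S. a \<noteq> \<zero>\<^bsub>S\<^esub> \<longrightarrow> bij_betw (\<lambda>x. a \<otimes>\<^bsub>S\<^esub> x) (carrier S) (carrier S))"

text \<open>
  The remaining facts justify the encoding: \<open>D[t;\<sigma>]\<close> is a ring with \<open>t a = \<sigma>(a) t\<close>, and quotient and
  remainder of right division exist and are unique, so that the description operator in
  \<open>mod_right\<close> is well-defined.
\<close>

lemma endo_simps:
  assumes "ring_endomorphism \<sigma>"
  shows "\<sigma> 0 = 0" "\<sigma> (- a) = - \<sigma> a" "\<sigma> a = 0 \<longleftrightarrow> a = 0"
proof -
  have add: "\<sigma> (a + b) = \<sigma> a + \<sigma> b" and mul: "\<sigma> (a * b) = \<sigma> a * \<sigma> b" and one: "\<sigma> 1 = 1" for a b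
    using assms by (auto simp: ring_endomorphism_def)
  show z: "\<sigma> 0 = 0" using add[of 0 0] by simp
  show "\<sigma> (- a) = - \<sigma> a" using add[of a "- a"] z by (simp add: eq_neg_iff_add_eq_0 add.commute)
  show "\<sigma> a = 0 \<longleftrightarrow> a = 0"
    using mul[of a "inverse a"] one z by (cases "a = 0") auto
qed

lemma endo_funpow: "ring_endomorphism \<sigma> \<Longrightarrow> ring_endomorphism (\<sigma> ^^ n)"
  by (induction n) (auto simp: ring_endomorphism_def)

context
  fixes \<sigma> :: "'a::division_ring \<Rightarrow> 'a"
  assumes endo: "ring_endomorphism \<sigma>"
begin

lemma endo_pow_simps:
  "(\<sigma> ^^ n) 0 = 0" "(\<sigma> ^^ n) 1 = 1" "(\<sigma> ^^ n) (a + b) = (\<sigma> ^^ n) a + (\<sigma> ^^ n) b"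
  "(\<sigma> ^^ n) (a * b) = (\<sigma> ^^ n) a * (\<sigma> ^^ n) b" "(\<sigma> ^^ n) a = 0 \<longleftrightarrow> a = 0"
  using endo_funpow[OF endo, of n] endo_simps[of "\<sigma> ^^ n"] by (auto simp: ring_endomorphism_def)

lemma twisted_mult_bounds:
  assumes "degree p \<le> N" "degree q \<le> M"
  shows "twisted_mult \<sigma> p q = (\<Sum>i\<le>N. \<Sum>j\<le>M. monom (coeff p i * (\<sigma> ^^ i) (coeff q j)) (i + j))"
proof -
  have "twisted_mult \<sigma> p q = (\<Sum>i\<le>degree p. \<Sum>j\<le>M. monom (coeff p i * (\<sigma> ^^ i) (coeff q j)) (i + j))"
    unfolding twisted_mult_def using assms
    by (intro sum.cong refl sum.mono_neutral_left) (auto simp: coeff_eq_0 endo_pow_simps)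
  also have "\<dots> = (\<Sum>i\<le>N. \<Sum>j\<le>M. monom (coeff p i * (\<sigma> ^^ i) (coeff q j)) (i + j))"
    using assms by (intro sum.mono_neutral_left) (auto simp: coeff_eq_0)
  finally show ?thesis .
qed

lemma twisted_mult_add_left:
  "twisted_mult \<sigma> (p + p') q = twisted_mult \<sigma> p q + twisted_mult \<sigma> p' q"
proof -
  define N where "N = max (degree p) (degree p')"
  have "degree p \<le> N" "degree p' \<le> N" "degree (p + p') \<le> N"
    by (auto simp: N_def degree_add_le_max)
  thus ?thesis
    by (simp add: twisted_mult_bounds[OF _ order_refl, of _ N] algebra_simps add_monom[symmetric] sum.distrib)
qed

lemma twisted_mult_add_right:
  "twisted_mult \<sigma> p (q + q') = twisted_mult \<sigma> p q + twisted_mult \<sigma> p q'"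
proof -
  define N where "N = max (degree q) (degree q')"
  have "degree q \<le> N" "degree q' \<le> N" "degree (q + q') \<le> N"
    by (auto simp: N_def degree_add_le_max)
  thus ?thesis
    by (simp add: twisted_mult_bounds[OF order_refl, of _ N] endo_pow_simps algebra_simps add_monom[symmetric] sum.distrib)
qed

lemma twisted_mult_0 [simp]: "twisted_mult \<sigma> 0 q = 0" "twisted_mult \<sigma> p 0 = 0"
  by (simp_all add: twisted_mult_def endo_pow_simps)

lemma twisted_mult_monom:
  "twisted_mult \<sigma> (monom a i) (monom b j) = monom (a * (\<sigma> ^^ i) b) (i + j)"
proof -
  have "twisted_mult \<sigma> (monom a i) (monom b j) =
    (\<Sum>k\<le>i. \<Sum>l\<le>j. monom (coeff (monom a i) k * (\<sigma> ^^ k) (coeff (monom b j) l)) (k + l))"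
    by (rule twisted_mult_bounds) (auto simp: degree_monom_le)
  also have "\<dots> = (\<Sum>k\<le>i. if k = i then \<Sum>l\<le>j. if l = j then monom (a * (\<sigma> ^^ i) b) (i + j) else 0 else 0)"
  proof (intro sum.cong refl)
    fix k
    have "(\<Sum>l\<le>j. monom (a * (\<sigma> ^^ i) (coeff (monom b j) l)) (i + l)) =
          (\<Sum>l\<le>j. if l = j then monom (a * (\<sigma> ^^ i) b) (i + j) else 0)"
      by (intro sum.cong refl) (auto simp: endo_pow_simps)
    thus "(\<Sum>l\<le>j. monom (coeff (monom a i) k * (\<sigma> ^^ k) (coeff (monom b j) l)) (k + l)) =
          (if k = i then \<Sum>l\<le>j. if l = j then monom (a * (\<sigma> ^^ i) b) (i + j) else 0 else 0)"
      by (cases "k = i") simp_all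
  qed
  also have "\<dots> = monom (a * (\<sigma> ^^ i) b) (i + j)" by simp
  finally show ?thesis .
qed

lemma twisted_mult_sum_left: "twisted_mult \<sigma> (sum p A) q = (\<Sum>x\<in>A. twisted_mult \<sigma> (p x) q)"
  by (induction A rule: infinite_finite_induct) (auto simp: twisted_mult_add_left)

lemma twisted_mult_sum_right: "twisted_mult \<sigma> p (sum q A) = (\<Sum>x\<in>A. twisted_mult \<sigma> p (q x))"
  by (induction A rule: infinite_finite_induct) (auto simp: twisted_mult_add_right)

lemma monom_expand: obtains A and c :: "nat \<Rightarrow> 'a" where "p = (\<Sum>i\<in>A. monom (c i) i)"
  using poly_as_sum_of_monoms[of p] by metis

lemma twisted_mult_assoc:
  "twisted_mult \<sigma> (twisted_mult \<sigma> p q) r = twisted_mult \<sigma> p (twisted_mult \<sigma> q r)"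
proof -
  obtain A a where p: "p = (\<Sum>i\<in>A. monom (a i) i)" by (rule monom_expand)
  obtain B b where q: "q = (\<Sum>i\<in>B. monom (b i) i)" by (rule monom_expand)
  obtain C c where r: "r = (\<Sum>i\<in>C. monom (c i) i)" by (rule monom_expand)
  show ?thesis unfolding p q r
    by (simp add: twisted_mult_sum_left twisted_mult_sum_right twisted_mult_monom endo_pow_simps
         funpow_add mult.assoc add.assoc)
qed

lemma twisted_mult_one: "twisted_mult \<sigma> [:1:] p = p" "twisted_mult \<sigma> p [:1:] = p"
proof -
  obtain A a where p: "p = (\<Sum>i\<in>A. monom (a i) i)" by (rule monom_expand)
  have 1: "[:1:] = (monom 1 0 :: 'a poly)" by (simp add: monom_0)
  show "twisted_mult \<sigma> [:1:] p = p" "twisted_mult \<sigma> p [:1:] = p"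
    unfolding 1 p
    by (simp_all add: twisted_mult_sum_left twisted_mult_sum_right twisted_mult_monom endo_pow_simps)
qed

lemma twisted_poly_ring: "ring (twisted_poly_ring \<sigma>)"
proof (rule ringI)
  show "abelian_group (twisted_poly_ring \<sigma>)"
    by (rule abelian_groupI)
       (auto simp: twisted_poly_ring_def algebra_simps intro: exI[of _ "- _"] left_minus)
  show "Group.monoid (twisted_poly_ring \<sigma>)"
    by (rule monoidI) (auto simp: twisted_poly_ring_def twisted_mult_assoc twisted_mult_one)
qed (auto simp: twisted_poly_ring_def twisted_mult_add_left twisted_mult_add_right)

lemma twisted_poly_ring_t: "twisted_mult \<sigma> (monom 1 1) [:a:] = twisted_mult \<sigma> [:\<sigma> a:] (monom 1 1)"
  using twisted_mult_monom[of 1 1 a 0] twisted_mult_monom[of "\<sigma> a" 0 1 1] by (simp add: monom_0)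

lemma degree_twisted_mult_le: "degree (twisted_mult \<sigma> p q) \<le> degree p + degree q"
  unfolding twisted_mult_def
  by (intro degree_sum_le) (auto intro!: order_trans[OF degree_monom_le] add_mono)

lemma lead_coeff_twisted_mult:
  "coeff (twisted_mult \<sigma> p q) (degree p + degree q) = lead_coeff p * (\<sigma> ^^ degree p) (lead_coeff q)"
proof -
  have "coeff (twisted_mult \<sigma> p q) (degree p + degree q) =
    (\<Sum>i\<le>degree p. \<Sum>j\<le>degree q. if i = degree p \<and> j = degree q then coeff p i * (\<sigma> ^^ i) (coeff q j) else 0)"
    unfolding twisted_mult_def by (simp add: coeff_sum) (intro sum.cong refl, auto)
  also have "\<dots> = (\<Sum>i\<le>degree p. if i = degree p then
     \<Sum>j\<le>degree q. if j = degree q then coeff p i * (\<sigma> ^^ i) (coeff q j) else 0 else 0)"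
    by (intro sum.cong refl) auto
  finally show ?thesis by simp
qed

lemma degree_twisted_mult:
  assumes "p \<noteq> 0" "q \<noteq> 0" shows "degree (twisted_mult \<sigma> p q) = degree p + degree q"
  using lead_coeff_twisted_mult[of p q] assms degree_twisted_mult_le[of p q]
  by (intro antisym le_degree) (auto simp: endo_pow_simps)

lemma right_division_ex:
  assumes "f \<noteq> 0"
  shows "\<exists>q r. g = twisted_mult \<sigma> q f + r \<and> (r = 0 \<or> degree r < degree f)"
proof (induction "degree g" arbitrary: g rule: less_induct)
  case less
  show ?case
  proof (cases "g = 0 \<or> degree g < degree f")
    case True
    thus ?thesis by (intro exI[of _ 0] exI[of _ g]) auto
  next
    case False
    define k where "k = degree g - degree f"
    define c where "c = monom (lead_coeff g * inverse ((\<sigma> ^^ k) (lead_coeff f))) k"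
    have nz: "lead_coeff g * inverse ((\<sigma> ^^ k) (lead_coeff f)) \<noteq> 0"
      using False assms by (simp add: endo_pow_simps)
    have dc: "degree c = k" unfolding c_def using nz by (rule degree_monom_eq)
    define h where "h = g - twisted_mult \<sigma> c f"
    have dg: "degree c + degree f = degree g" using False dc by (simp add: k_def)
    have "coeff h (degree g) = 0"
      using lead_coeff_twisted_mult[of c f] dg nz assms
      by (simp add: h_def dc) (simp add: c_def mult.assoc endo_pow_simps)
    moreover have "degree h \<le> degree g"
      unfolding h_def using degree_twisted_mult_le[of c f] dg by (intro degree_diff_le) auto
    ultimately have h: "h = 0 \<or> degree h < degree g"
      by (metis leading_coeff_0_iff le_neq_implies_less)
    have "\<exists>q r. h = twisted_mult \<sigma> q f + r \<and> (r = 0 \<or> degree r < degree f)"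
    proof (cases "h = 0")
      case True thus ?thesis by (intro exI[of _ 0]) auto
    next
      case False with h less show ?thesis by blast
    qed
    then obtain q r where qr: "h = twisted_mult \<sigma> q f + r" "r = 0 \<or> degree r < degree f" by blast
    have "g = twisted_mult \<sigma> (c + q) f + r"
      using qr(1) by (simp add: h_def twisted_mult_add_left algebra_simps)
    with qr(2) show ?thesis by blast
  qed
qed

lemma right_division_unique:
  assumes "f \<noteq> 0" "twisted_mult \<sigma> q f + r = twisted_mult \<sigma> q' f + r'"
    "r = 0 \<or> degree r < degree f" "r' = 0 \<or> degree r' < degree f"
  shows "q = q' \<and> r = r'"
proof -
  have "twisted_mult \<sigma> q f = twisted_mult \<sigma> (q - q') f + twisted_mult \<sigma> q' f"
    by (simp flip: twisted_mult_add_left)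
  hence eq: "twisted_mult \<sigma> (q - q') f = r' - r" using assms(2) by (simp add: algebra_simps)
  have "q = q'"
  proof (rule ccontr)
    assume "q \<noteq> q'"
    hence d: "degree (r' - r) = degree (q - q') + degree f"
      using degree_twisted_mult[of "q - q'" f] assms(1) eq by simp
    have "lead_coeff (q - q') * (\<sigma> ^^ degree (q - q')) (lead_coeff f) \<noteq> 0"
      using \<open>q \<noteq> q'\<close> assms(1) by (simp add: endo_pow_simps del: coeff_diff)
    hence "r' - r \<noteq> 0" using lead_coeff_twisted_mult[of "q - q'" f] unfolding eq
      by (metis coeff_0)
    hence "degree (r' - r) < degree f" using assms(3,4) 
      by (auto intro: degree_diff_less)
    with d show False by simp
  qed
  with assms(2) show ?thesis by simp
qed

lemma mod_right_exists_unique: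
  assumes "f \<noteq> 0" shows "\<exists>!r. is_right_remainder \<sigma> f g r"
  using right_division_ex[OF assms, of g] right_division_unique[OF assms]
  unfolding is_right_remainder_def by metis

end

end

theory Submission
  imports Defs
begin

text \<open>
  Write \<open>R = D[t;\<sigma>]\<close> and \<open>m = deg f\<close>. Right division makes the Euclidean algorithm available in
  \<open>R\<close>, and the whole theorem rests on it.

  Since \<open>f\<close> is irreducible, every nonzero \<open>a\<close> of degree below \<open>m\<close> is right coprime to \<open>f\<close>: the last
  nonzero remainder is a common right divisor of \<open>a\<close> and \<open>f\<close>, so it is a constant, and
  \<open>u a + v f = 1\<close> for some \<open>u\<close>, \<open>v\<close> (\<open>irreducible_right_coprime\<close>). The right multiplication
  \<open>x \<mapsto> x a mod f\<close> is the map \<open>R \<rightarrow> R / R f\<close>, \<open>x \<mapsto> x a\<close>, restricted to polynomials of degree below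
  \<open>m\<close>. On all of \<open>R\<close> this map is surjective by the Bezout identity. Its kernel is a left ideal,
  which contains a nonzero element of degree at most \<open>m\<close> (\<open>common_left_multiple\<close>) but none of
  smaller degree (\<open>degree_common_left_multiple\<close>). The first fact lets every \<open>x\<close> be reduced to degree
  below \<open>m\<close>, so the restriction is still surjective; the second makes it injective. One could
  instead count dimensions of left \<open>D\<close>-vector spaces; following degrees along the Euclidean
  algorithm replaces this.

  Left multiplication by \<open>t\<close> is not surjective. Pick \<open>c\<close> outside the range of \<open>\<sigma>\<close> and
  suppose \<open>t x = q f + c t\<close> with \<open>deg x < m\<close>. Comparing degrees, \<open>q\<close> is a constant. The
  left-hand side has constant term zero, while \<open>f\<close> does not, since otherwise \<open>t\<close> would be a right
  factor of \<open>f\<close>. Hence \<open>q = 0\<close>, and comparing the coefficients at \<open>t\<close> gives \<open>c = \<sigma>(x\<^sub>0)\<close>, a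
  contradiction.
\<close>

section \<open>Products of twisted polynomials\<close>

context
  fixes \<sigma> :: "'a::division_ring \<Rightarrow> 'a"
  assumes endo [simp]: "ring_endomorphism \<sigma>"
begin

lemma twisted_mult_diff_left:
  "twisted_mult \<sigma> (p - p') q = twisted_mult \<sigma> p q - twisted_mult \<sigma> p' q"
  using twisted_mult_add_left[OF endo, of "p - p'" p' q] by (simp add: algebra_simps)

lemma twisted_mult_eq_0_iff: "twisted_mult \<sigma> p q = 0 \<longleftrightarrow> p = 0 \<or> q = 0"
proof
  assume "twisted_mult \<sigma> p q = 0"
  thus "p = 0 \<or> q = 0"
    using lead_coeff_twisted_mult[OF endo, of p q] by (simp add: endo_pow_simps)
qed auto

lemma coeff_0_twisted_mult: "coeff (twisted_mult \<sigma> p q) 0 = coeff p 0 * coeff q 0"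
proof -
  have "coeff (twisted_mult \<sigma> p q) 0 =
      (\<Sum>i\<le>degree p. \<Sum>j\<le>degree q. if i = 0 \<and> j = 0 then coeff p 0 * coeff q 0 else 0)"
    unfolding twisted_mult_def by (simp add: coeff_sum) (intro sum.cong refl, auto)
  also have "\<dots> = (\<Sum>i\<le>degree p. if i = 0 then
      \<Sum>j\<le>degree q. if j = 0 then coeff p 0 * coeff q 0 else 0 else 0)"
    by (intro sum.cong refl) auto
  finally show ?thesis by simp
qed

lemma coeff_1_t_twisted_mult: "coeff (twisted_mult \<sigma> (monom 1 1) x) 1 = \<sigma> (coeff x 0)"
proof -
  have "coeff (twisted_mult \<sigma> (monom 1 1) x) 1 =
      (\<Sum>j\<le>degree x. if j = 0 then \<sigma> (coeff x 0) else 0)"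
    by (subst twisted_mult_bounds[where N = 1 and M = "degree x"])
       (auto simp: coeff_sum degree_monom_eq intro!: sum.cong)
  thus ?thesis by simp
qed

lemma twisted_mult_t_right: "twisted_mult \<sigma> p (monom 1 1) = pCons 0 p"
proof -
  have "twisted_mult \<sigma> p (monom 1 1)
      = twisted_mult \<sigma> (\<Sum>i\<le>degree p. monom (coeff p i) i) (monom 1 1)"
    by (simp add: poly_as_sum_of_monoms)
  also have "\<dots> = (\<Sum>i\<le>degree p. monom (coeff p i) (Suc i))"
    by (simp add: twisted_mult_sum_left twisted_mult_monom endo_pow_simps)
  also have "\<dots> = pCons 0 (\<Sum>i\<le>degree p. monom (coeff p i) i)"
    by (rule poly_eqI) (simp add: monom_Suc coeff_sum coeff_pCons split: nat.split)
  finally show ?thesis by (simp add: poly_as_sum_of_monoms)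
qed

section \<open>The Euclidean algorithm and common left multiples\<close>

text \<open>
  The Euclidean algorithm: a common right divisor of \<open>b - s a\<close> and \<open>a\<close> also divides \<open>b\<close> on the
  right, and \<open>a\<close> may be replaced by a remainder of smaller degree until the division is exact.
\<close>

lemma right_bezout:
  assumes "a \<noteq> 0"
  shows "\<exists>d u v a' b'. d = twisted_mult \<sigma> u a + twisted_mult \<sigma> v b \<and>
           a = twisted_mult \<sigma> a' d \<and> b = twisted_mult \<sigma> b' d"
  using assms
proof (induction "degree a" arbitrary: a b rule: less_induct)
  case less
  obtain s r where b: "b = twisted_mult \<sigma> s a + r" and r: "r = 0 \<or> degree r < degree a"
    using right_division_ex[OF endo less.prems] by blast
  show ?case
  proof (cases "r = 0")
    case True
    show ?thesis
      by (rule exI[of _ a], rule exI[of _ "[:1:]"], rule exI[of _ 0],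
          rule exI[of _ "[:1:]"], rule exI[of _ s])
         (simp add: b True twisted_mult_one)
  next
    case False
    with r have "degree r < degree a" by simp
    from less.hyps[OF this False, of a] obtain d u v r' a' where d: "d = twisted_mult \<sigma> u r + twisted_mult \<sigma> v a"
      and r': "r = twisted_mult \<sigma> r' d" and a': "a = twisted_mult \<sigma> a' d"
      by (elim exE conjE)
    have "d = twisted_mult \<sigma> (v - twisted_mult \<sigma> u s) a + twisted_mult \<sigma> u b"
      by (subst d) (simp add: b twisted_mult_diff_left twisted_mult_add_right twisted_mult_assoc)
    moreover have "b = twisted_mult \<sigma> (twisted_mult \<sigma> s a' + r') d"
      using b r' a' by (simp add: twisted_mult_add_left twisted_mult_assoc)
    ultimately show ?thesis using a' by (intro exI conjI)
  qed
qed

text \<open>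
  From \<open>b = s a + r\<close> and \<open>p r = q a\<close> follows \<open>p b = (p s + q) a\<close>. The degree bound survives the
  step because the degrees of the two sides of a common multiple are linked:
  \<open>deg (p s + q) = deg p + deg b - deg a\<close>, and \<open>deg p \<le> deg a\<close> by induction.
\<close>

lemma common_left_multiple:
  assumes "a \<noteq> 0" "b \<noteq> 0"
  shows "\<exists>p q. p \<noteq> 0 \<and> degree p \<le> degree b \<and> twisted_mult \<sigma> p a = twisted_mult \<sigma> q b"
  using assms
proof (induction "degree a" arbitrary: a b rule: less_induct)
  case less
  obtain s r where b: "b = twisted_mult \<sigma> s a + r" and r: "r = 0 \<or> degree r < degree a"
    using right_division_ex[OF endo less.prems(1)] by blast
  show ?case
  proof (cases "r = 0")
    case True
    with b less.prems have "s \<noteq> 0" by auto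
    hence "degree s \<le> degree b"
      using b True less.prems by (simp add: degree_twisted_mult)
    with \<open>s \<noteq> 0\<close> b True show ?thesis
      by (intro exI[of _ s] exI[of _ "[:1:]"]) (simp add: twisted_mult_one)
  next
    case False
    with r have "degree r < degree a" by simp
    from less.hyps[OF this False less.prems(1)]
    obtain p q where p: "p \<noteq> 0" "degree p \<le> degree a"
      and pq: "twisted_mult \<sigma> p r = twisted_mult \<sigma> q a"
      by (elim exE conjE)
    define k where "k = twisted_mult \<sigma> p s + q"
    have k: "twisted_mult \<sigma> k a = twisted_mult \<sigma> p b"
      by (simp add: k_def b pq twisted_mult_add_left twisted_mult_add_right twisted_mult_assoc)
    have "twisted_mult \<sigma> k a \<noteq> 0"
      using k p less.prems by (simp add: twisted_mult_eq_0_iff)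
    hence "k \<noteq> 0" by (auto simp: twisted_mult_eq_0_iff)
    have "degree k + degree a = degree p + degree b"
      using degree_twisted_mult[OF endo \<open>k \<noteq> 0\<close> less.prems(1)]
        degree_twisted_mult[OF endo p(1) less.prems(2)] k by simp
    with p \<open>k \<noteq> 0\<close> k show ?thesis by (intro exI[of _ k] exI[of _ p]) auto
  qed
qed

text \<open>
  A division step \<open>b = s a + r\<close> turns the common multiple \<open>p a = q b\<close> into \<open>q r = (p - q s) a\<close>
  and keeps the pair coprime. By induction \<open>deg q \<ge> deg a\<close>, and
  \<open>deg p + deg a = deg q + deg b\<close> transfers the bound to \<open>p\<close>. The algorithm stops when \<open>a\<close>
  is a unit.
\<close>

lemma degree_common_left_multiple:
  assumes "a \<noteq> 0" "b \<noteq> 0" "p \<noteq> 0"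
    and "twisted_mult \<sigma> u a + twisted_mult \<sigma> v b = [:1:]"
    and "twisted_mult \<sigma> p a = twisted_mult \<sigma> q b"
  shows "degree b \<le> degree p"
  using assms
proof (induction "degree a" arbitrary: a b p q u v rule: less_induct)
  case less
  have "twisted_mult \<sigma> q b \<noteq> 0"
    using less.prems by (metis twisted_mult_eq_0_iff)
  hence q: "q \<noteq> 0" by (auto simp: twisted_mult_eq_0_iff)
  have deg: "degree p + degree a = degree q + degree b"
    using degree_twisted_mult[OF endo less.prems(3,1)] degree_twisted_mult[OF endo q less.prems(2)]
      less.prems(5) by simp
  obtain s r where b: "b = twisted_mult \<sigma> s a + r" and r: "r = 0 \<or> degree r < degree a"
    using right_division_ex[OF endo less.prems(1)] by blast
  have cop: "twisted_mult \<sigma> v r + twisted_mult \<sigma> (u + twisted_mult \<sigma> v s) a = [:1:]"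
    using less.prems(4)
    by (simp add: b twisted_mult_add_left twisted_mult_add_right twisted_mult_assoc algebra_simps)
  have mult: "twisted_mult \<sigma> q r = twisted_mult \<sigma> (p - twisted_mult \<sigma> q s) a"
    using less.prems(5)
    by (simp add: b twisted_mult_diff_left twisted_mult_add_right twisted_mult_assoc algebra_simps)
  show ?case
  proof (cases "r = 0")
    case True
    define w where "w = u + twisted_mult \<sigma> v s"
    have w: "twisted_mult \<sigma> w a = [:1:]" using cop True by (simp add: w_def)
    hence "w \<noteq> 0" by auto
    with w less.prems(1) have "degree w + degree a = 0"
      by (metis degree_twisted_mult[OF endo] degree_pCons_0)
    with deg show ?thesis by simp
  next
    case False
    with r less.hyps[OF _ False less.prems(1) q cop mult] deg show ?thesis by auto
  qed
qed

section \<open>Irreducible polynomials\<close>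

text \<open>
  Irreducibility applies to the factorisation of \<open>f\<close> through its greatest common right divisor \<open>d\<close>
  with \<open>a\<close>. Since \<open>deg d \<le> deg a < deg f\<close>, the cofactor must have full degree, so \<open>d\<close> is a
  nonzero constant and can be scaled to one.
\<close>

lemma irreducible_right_coprime:
  assumes "twisted_irreducible \<sigma> f" "a \<noteq> 0" "degree a < degree f"
  shows "\<exists>u v. twisted_mult \<sigma> u a + twisted_mult \<sigma> v f = [:1:]"
proof -
  obtain d u v a' f' where d: "d = twisted_mult \<sigma> u a + twisted_mult \<sigma> v f"
    and a: "a = twisted_mult \<sigma> a' d" and f: "f = twisted_mult \<sigma> f' d"
    using right_bezout[OF assms(2), of f] by (elim exE conjE)
  have nz: "a' \<noteq> 0" "f' \<noteq> 0" "d \<noteq> 0"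
    using a f assms(2,3) twisted_mult_0[OF endo] by (metis, metis degree_0 not_less0, metis)
  have "degree d \<le> degree a" using degree_twisted_mult[OF endo nz(1,3)] a by simp
  hence "degree d < degree f" using assms(3) by simp
  hence "\<not> degree f' < degree f" using assms(1) f unfolding twisted_irreducible_def by blast
  hence "degree d = 0" using degree_twisted_mult[OF endo nz(2,3)] f by simp
  then obtain c where c: "d = [:c:]" by (rule degree_eq_zeroE)
  define e where "e = [:inverse c:]"
  have "twisted_mult \<sigma> e d = [:1:]"
    using twisted_mult_monom[OF endo, of "inverse c" 0 c 0] nz(3) c
    by (simp add: e_def monom_0)
  hence "twisted_mult \<sigma> (twisted_mult \<sigma> e u) a + twisted_mult \<sigma> (twisted_mult \<sigma> e v) f = [:1:]"
    by (simp add: d twisted_mult_add_right twisted_mult_assoc)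
  thus ?thesis by blast
qed

lemma irreducible_coeff_0:
  assumes "twisted_irreducible \<sigma> f" "degree f \<ge> 2"
  shows "coeff f 0 \<noteq> 0"
proof
  assume "coeff f 0 = 0"
  then obtain g where g: "f = pCons 0 g" by (metis coeff_pCons_0 pCons_cases)
  have "g \<noteq> 0"
  proof
    assume "g = 0"
    with g have "f = 0" by simp
    with assms(2) show False by simp
  qed
  with g have "degree g < degree f" by (metis degree_pCons_eq lessI)
  moreover have "degree (monom (1::'a) 1) < degree f"
    using assms(2) by (simp add: degree_monom_eq)
  moreover have "f = twisted_mult \<sigma> g (monom 1 1)" using g twisted_mult_t_right[of g] by simp
  ultimately show False using assms(1) unfolding twisted_irreducible_def by blast
qed

section \<open>Division in the Petit algebra\<close>

lemma mod_right_eq_iff: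
  assumes "degree f > 0" "degree r < degree f"
  shows "mod_right \<sigma> g f = r \<longleftrightarrow> (\<exists>q. g = twisted_mult \<sigma> q f + r)"
proof -
  have "f \<noteq> 0" using assms by auto
  note ex1 = mod_right_exists_unique[OF endo this, of g]
  have "mod_right \<sigma> g f = r \<longleftrightarrow> is_right_remainder \<sigma> f g r"
    using theI'[OF ex1] the1_equality[OF ex1] unfolding mod_right_def by blast
  thus ?thesis using assms by (simp add: is_right_remainder_def)
qed

lemma degree_mod_right:
  assumes "degree f > 0"
  shows "degree (mod_right \<sigma> g f) < degree f"
proof -
  have "f \<noteq> 0" using assms by auto
  from theI'[OF mod_right_exists_unique[OF endo this, of g]] show ?thesis
    using assms unfolding mod_right_def is_right_remainder_def by auto
qed

lemma right_division_petit_algebra: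
  assumes irr: "twisted_irreducible \<sigma> f" and pos: "degree f > 0"
  shows "right_division_algebra (petit_algebra \<sigma> f)"
proof -
  have "bij_betw (\<lambda>x. mod_right \<sigma> (twisted_mult \<sigma> x a) f)
          {g. degree g < degree f} {g. degree g < degree f}"
    if a: "degree a < degree f" "a \<noteq> 0" for a
  proof -
    have f: "f \<noteq> 0" using pos by auto
    obtain u v where uv: "twisted_mult \<sigma> u a + twisted_mult \<sigma> v f = [:1:]"
      using irreducible_right_coprime[OF irr a(2,1)] by blast
    obtain k l where k: "k \<noteq> 0" "degree k \<le> degree f"
      and kl: "twisted_mult \<sigma> k a = twisted_mult \<sigma> l f"
      using common_left_multiple[OF a(2) f] by blast
    show ?thesis unfolding bij_betw_def
    proof (intro conjI inj_onI equalityI subsetI)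
      fix x y assume xy: "x \<in> {g. degree g < degree f}" "y \<in> {g. degree g < degree f}"
        "mod_right \<sigma> (twisted_mult \<sigma> x a) f = mod_right \<sigma> (twisted_mult \<sigma> y a) f"
      define r where "r = mod_right \<sigma> (twisted_mult \<sigma> y a) f"
      have "degree r < degree f" unfolding r_def using pos by (rule degree_mod_right)
      then obtain q q' where "twisted_mult \<sigma> x a = twisted_mult \<sigma> q f + r"
        "twisted_mult \<sigma> y a = twisted_mult \<sigma> q' f + r"
        using mod_right_eq_iff[OF pos] xy(3) r_def by metis
      hence eq: "twisted_mult \<sigma> (x - y) a = twisted_mult \<sigma> (q - q') f"
        by (simp add: twisted_mult_diff_left)
      have "degree (x - y) < degree f" using xy(1,2) by (simp add: degree_diff_less)
      thus "x = y" using degree_common_left_multiple[OF a(2) f _ uv eq] by force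
    next
      fix b :: "'a poly" assume "b \<in> {g. degree g < degree f}"
      hence b: "degree b < degree f" by simp
      \<comment> \<open>\<open>b u\<close> is a preimage of \<open>b\<close> in \<open>R\<close>; dividing it by the kernel element \<open>k\<close> lowers its degree.\<close>
      obtain c x where cx: "twisted_mult \<sigma> b u = twisted_mult \<sigma> c k + x"
        and x: "x = 0 \<or> degree x < degree k"
        using right_division_ex[OF endo k(1)] by blast
      have bua: "twisted_mult \<sigma> (twisted_mult \<sigma> b u) a = b - twisted_mult \<sigma> (twisted_mult \<sigma> b v) f"
        using arg_cong[OF uv, of "twisted_mult \<sigma> b"]
        by (simp add: twisted_mult_one twisted_mult_add_right twisted_mult_assoc algebra_simps)
      have "twisted_mult \<sigma> x a = b - twisted_mult \<sigma> (twisted_mult \<sigma> b v) f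
              - twisted_mult \<sigma> (twisted_mult \<sigma> c l) f"
        using bua kl by (simp add: cx twisted_mult_add_left twisted_mult_assoc algebra_simps)
      also have "\<dots> = twisted_mult \<sigma> (0 - twisted_mult \<sigma> b v - twisted_mult \<sigma> c l) f + b"
        by (simp only: twisted_mult_diff_left twisted_mult_0[OF endo]) simp
      finally have "mod_right \<sigma> (twisted_mult \<sigma> x a) f = b"
        using mod_right_eq_iff[OF pos b] by blast
      moreover have "degree x < degree f" using x k(2) pos by auto
      ultimately show "b \<in> (\<lambda>x. mod_right \<sigma> (twisted_mult \<sigma> x a) f) ` {g. degree g < degree f}"
        by blast
    qed (use pos in \<open>auto simp: degree_mod_right\<close>)
  qed
  thus ?thesis by (simp add: right_division_algebra_def petit_algebra_def)
qed

text \<open>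
  The witness is \<open>t\<close>, whose products with elements of the algebra miss \<open>c t\<close> for every \<open>c\<close> outside
  the range of \<open>\<sigma>\<close>. Both \<open>t\<close> and \<open>c t\<close> lie in the algebra because the degree of \<open>f\<close> is at least two.
\<close>

lemma not_left_division_petit_algebra:
  assumes irr: "twisted_irreducible \<sigma> f" and deg: "degree f \<ge> 2" and ns: "\<not> surj \<sigma>"
  shows "\<not> left_division_algebra (petit_algebra \<sigma> f)"
proof
  assume "left_division_algebra (petit_algebra \<sigma> f)"
  moreover have "degree (monom (1::'a) 1) < degree f" "monom (1::'a) 1 \<noteq> 0"
    using deg by (auto simp: degree_monom_eq simp del: One_nat_def)
  ultimately have surj: "(\<lambda>x. mod_right \<sigma> (twisted_mult \<sigma> (monom 1 1) x) f) ` {g. degree g < degree f}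
       = {g. degree g < degree f}"
    by (simp add: left_division_algebra_def petit_algebra_def bij_betw_def del: One_nat_def)
  obtain c where c: "c \<notin> range \<sigma>" using ns by blast
  have dc: "degree (monom c 1) < degree f"
    using degree_monom_le[of c 1] deg by linarith
  hence "monom c 1 \<in> (\<lambda>x. mod_right \<sigma> (twisted_mult \<sigma> (monom 1 1) x) f) ` {g. degree g < degree f}"
    unfolding surj by (rule CollectI)
  then obtain x where x: "degree x < degree f"
    and mod: "mod_right \<sigma> (twisted_mult \<sigma> (monom 1 1) x) f = monom c 1"
    by (elim imageE CollectE) simp
  have pos: "degree f > 0" using deg by simp
  obtain q where q: "twisted_mult \<sigma> (monom 1 1) x = twisted_mult \<sigma> q f + monom c 1"
    using mod mod_right_eq_iff[OF pos dc] by blast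
  have q0: "coeff q 0 = 0"
    using arg_cong[OF q, of "\<lambda>p. coeff p 0"] irreducible_coeff_0[OF irr deg]
    by (simp add: coeff_0_twisted_mult)
  have "q = 0"
  proof (rule ccontr)
    assume "q \<noteq> 0"
    moreover have "f \<noteq> 0" using deg by auto
    ultimately have "degree q + degree f = degree (twisted_mult \<sigma> q f)"
      by (simp add: degree_twisted_mult)
    also have "twisted_mult \<sigma> q f = twisted_mult \<sigma> (monom 1 1) x - monom c 1"
      using q by simp
    also have "degree \<dots> \<le> degree f"
      using degree_twisted_mult_le[OF endo, of "monom 1 1" x] x dc
      by (intro degree_diff_le) (auto simp: degree_monom_eq)
    finally have "degree q = 0" by simp
    with q0 \<open>q \<noteq> 0\<close> show False by (metis leading_coeff_0_iff)
  qed
  hence "\<sigma> (coeff x 0) = c"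
    using arg_cong[OF q, of "\<lambda>p. coeff p 1"] coeff_1_t_twisted_mult by simp
  with c show False by blast
qed

end

theorem corollary2p24:
  fixes \<sigma> :: "'a::division_ring \<Rightarrow> 'a" and f :: "'a poly"
  assumes "ring_endomorphism \<sigma>"
    and "\<not> surj \<sigma>"
    and "degree f \<ge> 2"
    and "twisted_irreducible \<sigma> f"
  shows "right_division_algebra (petit_algebra \<sigma> f) \<and> \<not> left_division_algebra (petit_algebra \<sigma> f)"
proof
  have "degree f > 0" using assms(3) by simp
  with assms(1,4) show "right_division_algebra (petit_algebra \<sigma> f)"
    by (rule right_division_petit_algebra)
  show "\<not> left_division_algebra (petit_algebra \<sigma> f)"
    using assms(1,4,3,2) by (rule not_left_division_petit_algebra)
qed

end
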